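(* Let $\Sigma=\{1,2,\ldots,n\}$, and let $\mathcal{L}$ be an $n\times n$ Latin square using the letters from $\Sigma$, with the first column in its natural order $(1,2,\ldots,n)$. For $t\in\Sigma$, let $\mathcal{L}_t$ denote the row of $\mathcal{L}$ whose entry in the first column is $t$, regarded as a string of $n$ letters. Define the Latin square morphism $\ell$ by $\ell(t)=\mathcal{L}_t$ for $t\in\Sigma$. Then for any $t\in\Sigma$, $\ell^\omega(t)$ is an overlap-free sequence.
   Context: An $n\times n$ Latin square on $\Sigma$ is an $n\times n$ table with entries in $\Sigma$ such that each letter of $\Sigma$ occurs exactly once in each row and exactly once in each column. $\Sigma^*\cup\Sigma^\omega$ denotes the set of all finite or infinite strings over $\Sigma$. A morphism is a map $h:\Sigma^*\cup\Sigma^\omega\to\Sigma^*\cup\Sigma^\omega$ satisfying $h(xy)=h(x)h(y)$ for $x$ a finite string and $y\in\Sigma^*\cup\Sigma^\omega$. The map $\ell$ given on letters is extended to strings by concatenation, i.e. $\ell(t_1t_2t_3\ldots)=\ell(t_1)\ell(t_2)\ell(t_3)\ldots$. Since the first column of $\mathcal{L}$ is in natural order, the string $\ell(t)$ begins with the letter $t$. Hence for each $k\ge 1$ the iterate $\ell^k(t)$ (of length $n^k$) is a prefix of $\ell^{k+1}(t)$. The sequence $\ell^\omega(t)$ is the limit of the strings $\ell(t),\ell^2(t),\ell^3(t),\ldots$, that is, the shortest element of $\Sigma^*\cup\Sigma^\omega$ having every $\ell^k(t)$ as a prefix; it is a fixed point of $\ell$. An overlap is a finite string of the form $c\mathbf{x}c\mathbf{x}c$,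 where $c$ is a single letter and $\mathbf{x}$ is a finite, possibly empty, string. A sequence is overlap-free if no overlap occurs in it as a contiguous block of letters. *)

theory Defs
  imports "HOL-Library.Omega_Words_Fun" "HOL-Library.Extended_Nat"
begin

section \<open>Finite and infinite strings\<close>

datatype 'a str = FinStr "'a list" | InfStr "'a word"

fun str_append :: "'a list \<Rightarrow> 'a str \<Rightarrow> 'a str" where
  "str_append u (FinStr v) = FinStr (u @ v)"
| "str_append u (InfStr f) = InfStr (u \<frown> f)"

fun str_length :: "'a str \<Rightarrow> enat" where
  "str_length (FinStr u) = enat (length u)"
| "str_length (InfStr f) = \<infinity>"

fun str_prefix :: "'a str \<Rightarrow> 'a str \<Rightarrow> bool" where
  "str_prefix (FinStr u) w \<longleftrightarrow> (\<exists>v. w = str_append u v)"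
| "str_prefix (InfStr f) w \<longleftrightarrow> w = InfStr f"

definition str_factor :: "'a list \<Rightarrow> 'a str \<Rightarrow> bool" where
  "str_factor u w \<longleftrightarrow> (\<exists>p v. w = str_append p (str_append u v))"

definition shortest_extension :: "(nat \<Rightarrow> 'a str) \<Rightarrow> 'a str \<Rightarrow> bool" where
  "shortest_extension us w \<longleftrightarrow> (\<forall>k. str_prefix (us k) w) \<and>
     (\<forall>v. (\<forall>k. str_prefix (us k) v) \<longrightarrow> str_length w \<le> str_length v)"

text \<open>Meaningful when each \<open>us k\<close> is a finite prefix of \<open>us (Suc k)\<close>; see
  \<open>ex1_shortest_extension\<close> below.\<close>

definition str_limit :: "(nat \<Rightarrow> 'a str) \<Rightarrow> 'a str" where
  "str_limit us = (THE w. shortest_extension us w)"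


section \<open>Morphisms and overlaps\<close>

fun extend_morphism :: "('a \<Rightarrow> 'b list) \<Rightarrow> 'a str \<Rightarrow> 'b str" where
  "extend_morphism h (FinStr u) = FinStr (concat (map h u))"
| "extend_morphism h (InfStr f) =
     str_limit (\<lambda>k. FinStr (concat (map h (map f [0..<k]))))"

definition omega_iterate :: "('a str \<Rightarrow> 'a str) \<Rightarrow> 'a \<Rightarrow> 'a str" where
  "omega_iterate g t = str_limit (\<lambda>k. (g ^^ Suc k) (FinStr [t]))"

definition is_overlap :: "'a list \<Rightarrow> bool" where
  "is_overlap u \<longleftrightarrow> (\<exists>c x. u = [c] @ x @ [c] @ x @ [c])"

definition overlap_free :: "'a str \<Rightarrow> bool" where
  "overlap_free w \<longleftrightarrow> \<not> (\<exists>u. is_overlap u \<and> str_factor u w)"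


section \<open>Latin squares\<close>

text \<open>Rows and columns are numbered \<open>1, \<dots>, n\<close>; \<open>L i j\<close> is the entry in row \<open>i\<close>, column \<open>j\<close>,
  and values outside this range are irrelevant.\<close>

definition latin_square :: "nat \<Rightarrow> 'a set \<Rightarrow> (nat \<Rightarrow> nat \<Rightarrow> 'a) \<Rightarrow> bool" where
  "latin_square n \<Sigma> L \<longleftrightarrow>
     (\<forall>i\<in>{1..n}. \<forall>j\<in>{1..n}. L i j \<in> \<Sigma>) \<and>
     (\<forall>i\<in>{1..n}. \<forall>a\<in>\<Sigma>. \<exists>!j. j \<in> {1..n} \<and> L i j = a) \<and>
     (\<forall>j\<in>{1..n}. \<forall>a\<in>\<Sigma>. \<exists>!i. i \<in> {1..n} \<and> L i j = a)"

definition latin_row :: "nat \<Rightarrow> (nat \<Rightarrow> nat \<Rightarrow> 'a) \<Rightarrow> 'a \<Rightarrow> 'a list" where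
  "latin_row n L t = map (L (THE i. i \<in> {1..n} \<and> L i 1 = t)) [1..<Suc n]"

definition latin_morphism :: "nat \<Rightarrow> (nat \<Rightarrow> nat \<Rightarrow> 'a) \<Rightarrow> 'a str \<Rightarrow> 'a str" where
  "latin_morphism n L = extend_morphism (latin_row n L)"


section \<open>The definitions by limits are well-defined\<close>

lemma str_append_append [simp]: "str_append u (str_append v w) = str_append (u @ v) w"
  by (cases w) auto

lemma str_append_Nil [simp]: "str_append [] w = w"
  by (cases w) auto

lemma str_length_append: "str_length (str_append u w) = enat (length u) + str_length w"
  by (cases w) auto

lemma length_le_str_append: "enat (length u) \<le> str_length (str_append u w)"
  by (cases w) auto

lemma conc_cancel: "u \<frown> f = u \<frown> g \<longleftrightarrow> f = g"
proof
  assume eq: "u \<frown> f = u \<frown> g"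
  have "f n = g n" for n
    using fun_cong[OF eq, of "n + length u"] by (simp add: conc_def)
  then show "f = g" by auto
qed simp

lemma str_append_cancel [simp]: "str_append u v = str_append u w \<longleftrightarrow> v = w"
  by (cases v; cases w) (auto simp: conc_cancel)

lemma ex1_shortest_extension:
  assumes fin: "\<And>k. us k = FinStr (xs k)"
    and step: "\<And>k. str_prefix (us k) (us (Suc k))"
  shows "\<exists>!w. shortest_extension us w"
proof -
  have step': "\<exists>v. xs (Suc k) = xs k @ v" for k
  proof -
    obtain v where "FinStr (xs (Suc k)) = str_append (xs k) v" using step[of k] fin by auto
    then show ?thesis by (cases v) auto
  qed
  have mono: "\<exists>v. xs m = xs k @ v" if "k \<le> m" for k m
    using that
  proof (induction m rule: dec_induct)
    case (step m)
    then show ?case using step'[of m] by auto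
  qed auto
  have pre: "str_prefix (us k) w \<longleftrightarrow> (\<exists>v. w = str_append (xs k) v)" for k w
    by (simp add: fin)
  show ?thesis
  proof (cases "\<exists>K. \<forall>k. length (xs k) \<le> length (xs K)")
    case True
    then obtain K where K: "\<And>k. length (xs k) \<le> length (xs K)" by auto
    have ex: "\<exists>v. xs K = xs k @ v" for k
    proof (cases "k \<le> K")
      case False
      then obtain v where "xs k = xs K @ v" using mono[of K k] by auto
      with K[of k] show ?thesis by auto
    qed (use mono in auto)
    have A: "\<forall>k. str_prefix (us k) (FinStr (xs K))"
    proof
      fix k
      from ex obtain v where "xs K = xs k @ v" by blast
      then have "FinStr (xs K) = str_append (xs k) (FinStr v)" by simp
      then show "str_prefix (us k) (FinStr (xs K))" unfolding pre by blast
    qed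
    have le: "enat (length (xs K)) \<le> str_length v" if "\<forall>k. str_prefix (us k) v" for v
      using that pre by (metis length_le_str_append)
    show ?thesis
    proof (intro ex1I)
      show "shortest_extension us (FinStr (xs K))"
        unfolding shortest_extension_def using A le by simp
    next
      fix w assume w: "shortest_extension us w"
      then obtain v where v: "w = str_append (xs K) v"
        unfolding shortest_extension_def pre by blast
      have "str_length w \<le> str_length (FinStr (xs K))"
        using w A unfolding shortest_extension_def by blast
      with v show "w = FinStr (xs K)"
        by (cases v) auto
    qed
  next
    case False
    have unb: "\<exists>k. m < length (xs k)" for m
    proof (induction m)
      case 0
      show ?case using False by (metis gr_zeroI le0 le_antisym not_le)
    next
      case (Suc m)
      then obtain k where k: "m < length (xs k)" by auto
      obtain j where "length (xs j) > length (xs k)" using False not_le by blast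
      with k show ?case by (intro exI[of _ j]) simp
    qed
    define f where "f m = xs (SOME k. m < length (xs k)) ! m" for m
    have f: "f m = xs k ! m" if "m < length (xs k)" for m k
    proof -
      define j where "j = (SOME k. m < length (xs k))"
      have j: "m < length (xs j)" unfolding j_def using unb by (rule someI_ex)
      have "xs j ! m = xs k ! m"
        using mono[of j k] mono[of k j] j that by (cases "j \<le> k") (auto simp: nth_append)
      then show ?thesis by (simp add: f_def j_def)
    qed
    have "InfStr f = str_append (xs k) (InfStr (\<lambda>m. f (m + length (xs k))))" for k
      using f by (auto simp: conc_def)
    then have A: "\<forall>k. str_prefix (us k) (InfStr f)" unfolding pre by blast
    have inf: "v = InfStr f" if v: "\<forall>k. str_prefix (us k) v" for v
    proof (cases v)
      case (FinStr u)
      obtain k where k: "length u < length (xs k)" using unb by blast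
      have "enat (length (xs k)) \<le> str_length v"
        using v pre by (metis length_le_str_append)
      with k FinStr show ?thesis by simp
    next
      case (InfStr g)
      have "g m = f m" for m
      proof -
        obtain k where k: "m < length (xs k)" using unb by blast
        obtain v' where v': "v = str_append (xs k) v'" using v pre by blast
        then obtain h where "g = xs k \<frown> h" using InfStr by (cases v') auto
        with k f show ?thesis by simp
      qed
      then show ?thesis using InfStr by auto
    qed
    show ?thesis
    proof (rule ex1I[of _ "InfStr f"])
      have "str_length (InfStr f) \<le> str_length v" if "\<forall>k. str_prefix (us k) v" for v
        using inf[OF that] by simp
      with A show "shortest_extension us (InfStr f)"
        unfolding shortest_extension_def by blast
    next
      show "w = InfStr f" if "shortest_extension us w" for w
        using that inf unfolding shortest_extension_def by blast
    qed
  qed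
qed

lemma str_limit_eqI:
  assumes "\<And>k. us k = FinStr (xs k)" "\<And>k. str_prefix (us k) (us (Suc k))"
    and "shortest_extension us w"
  shows "str_limit us = w"
  unfolding str_limit_def
  by (rule the1_equality, rule ex1_shortest_extension[of us xs]) (rule assms)+

lemma extend_morphism_append:
  fixes h :: "'a \<Rightarrow> 'b list"
  shows "extend_morphism h (str_append u w) = str_append (concat (map h u)) (extend_morphism h w)"
proof (cases w)
  case (InfStr f)
  define V where "V g k = FinStr (concat (map h (map g [0..<k])))" for g :: "'a word" and k
  have step: "str_prefix (V g k) (V g (Suc k))" for g k
  proof -
    have "V g (Suc k) = str_append (concat (map h (map g [0..<k]))) (FinStr (h (g k)))"
      by (simp add: V_def)
    then show ?thesis unfolding V_def str_prefix.simps by blast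
  qed
  let ?hu = "concat (map h u)"
  let ?g = "u \<frown> f"
  have lim: "shortest_extension (V f) (str_limit (V f))"
    unfolding str_limit_def
    by (rule theI', rule ex1_shortest_extension[of "V f" "\<lambda>k. concat (map h (map f [0..<k]))"])
      (rule V_def, rule step)
  have g_late: "V ?g (length u + k) = str_append ?hu (V f k)" for k
  proof -
    have "map ?g [0..<length u + k] = u @ map f [0..<k]"
      by (intro nth_equalityI) (auto simp: nth_append conc_def)
    then show ?thesis by (simp only: V_def map_append concat_append str_append.simps)
  qed
  have pre_app: "str_prefix (str_append ?hu (V f k)) v
      \<longleftrightarrow> (\<exists>v'. v = str_append ?hu v' \<and> str_prefix (V f k) v')" for k v
  proof -
    have "str_append (?hu @ x) v' = str_append ?hu (str_append x v')" for x v' by simp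
    then show ?thesis unfolding V_def str_append.simps str_prefix.simps by metis
  qed
  have trans: "str_prefix (V ?g k) v" if pre: "str_prefix (V ?g (Suc k)) v" for k v
  proof -
    obtain v' where "v = str_append (concat (map h (map ?g [0..<Suc k]))) v'"
      using pre unfolding V_def str_prefix.simps by blast
    then have "v = str_append (concat (map h (map ?g [0..<k]))) (str_append (h (?g k)) v')"
      by simp
    then show ?thesis unfolding V_def str_prefix.simps by blast
  qed
  have down: "str_prefix (V ?g k) v" if "str_prefix (V ?g (m + k)) v" for k m v
    using that by (induction m) (auto intro: trans)
  have all: "(\<forall>k. str_prefix (V ?g k) v)
      \<longleftrightarrow> (\<exists>v'. v = str_append ?hu v' \<and> (\<forall>k. str_prefix (V f k) v'))" for v
  proof
    assume "\<forall>k. str_prefix (V ?g k) v"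
    then have "\<forall>k. str_prefix (str_append ?hu (V f k)) v" by (metis g_late)
    then show "\<exists>v'. v = str_append ?hu v' \<and> (\<forall>k. str_prefix (V f k) v')"
      unfolding pre_app by (metis str_append_cancel)
  next
    assume "\<exists>v'. v = str_append ?hu v' \<and> (\<forall>k. str_prefix (V f k) v')"
    then have "\<forall>k. str_prefix (V ?g (length u + k)) v" unfolding g_late pre_app by blast
    then show "\<forall>k. str_prefix (V ?g k) v" using down by blast
  qed
  have "str_limit (V ?g) = str_append ?hu (str_limit (V f))"
  proof (rule str_limit_eqI[of "V ?g" "\<lambda>k. concat (map h (map ?g [0..<k]))"])
    show "shortest_extension (V ?g) (str_append ?hu (str_limit (V f)))"
      using lim unfolding shortest_extension_def all
      by (auto simp: str_length_append add_left_mono)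
  next
    show "str_prefix (V ?g k) (V ?g (Suc k))" for k by (rule step)
  qed (simp add: V_def)
  then show ?thesis
    by (simp only: InfStr str_append.simps extend_morphism.simps V_def[abs_def])
qed simp

lemma latin_iterate_prefix:
  assumes "latin_square n {1..n} L" and "\<forall>i\<in>{1..n}. L i 1 = i" and "t \<in> {1..n}"
  shows "str_prefix ((latin_morphism n L ^^ k) (FinStr [t]))
           ((latin_morphism n L ^^ Suc k) (FinStr [t]))"
proof -
  have "(THE i. i \<in> {1..n} \<and> L i 1 = t) = t"
    using assms(2,3) by (intro the_equality) auto
  then have "latin_row n L t = t # map (L t) [2..<Suc n]"
    using assms(2,3) by (simp add: latin_row_def upt_conv_Cons numeral_2_eq_2 del: upt_Suc)
  then have start: "latin_morphism n L (FinStr [t])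
      = str_append [t] (FinStr (map (L t) [2..<Suc n]))"
    by (simp add: latin_morphism_def del: upt_Suc)
  have app: "\<exists>u' v'. (latin_morphism n L ^^ k) (FinStr u) = FinStr u' \<and>
      (latin_morphism n L ^^ k) (str_append u v) = str_append u' v'" for u v
    by (induction k) (auto simp: latin_morphism_def extend_morphism_append)
  show ?thesis
    using app[of "[t]" "FinStr (map (L t) [2..<Suc n])"] start
    by (auto simp: funpow_swap1 simp del: str_append.simps)
qed

lemma shortest_extension_omega_iterate:
  assumes "latin_square n {1..n} L" and "\<forall>i\<in>{1..n}. L i 1 = i" and "t \<in> {1..n}"
  shows "shortest_extension (\<lambda>k. (latin_morphism n L ^^ Suc k) (FinStr [t]))
           (omega_iterate (latin_morphism n L) t)"
proof -
  have "\<exists>u. (latin_morphism n L ^^ k) (FinStr [t]) = FinStr u" for k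
    by (induction k) (auto simp: latin_morphism_def)
  then obtain xs where xs: "\<And>k. (latin_morphism n L ^^ k) (FinStr [t]) = FinStr (xs k)"
    by metis
  show ?thesis
    unfolding omega_iterate_def str_limit_def
    by (rule theI', rule ex1_shortest_extension[of _ "\<lambda>k. xs (Suc k)"])
      (rule xs, rule latin_iterate_prefix[OF assms])
qed

end

theory Submission
  imports Defs
begin

text \<open>
  Suppose that \<open>w = \<ell>\<^sup>\<omega>(t)\<close> contains an overlap of period \<open>m\<close>, so that
  \<open>w i = w (i + m)\<close> for \<open>p \<le> i \<le> p + m\<close>; cut \<open>w\<close> into blocks of length \<open>n\<close>, each a row of
  the Latin square.  If \<open>n\<close> divides \<open>m\<close>, the columns being permutations, \<open>w\<close> contains an overlap
  of period \<open>m / n\<close>, and one descends.  If \<open>m < n\<close>, two equal letters lie in one block.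
  Otherwise \<open>m = a n + b\<close> with \<open>a \<ge> 1\<close> and \<open>0 < b < n\<close>.  All windows of length \<open>m\<close> inside the
  overlap contain a given letter equally often, while \<open>a\<close> consecutive blocks contain it \<open>a\<close> times.
  If \<open>q\<close> is the block of the central position \<open>p + m\<close>, it follows that the first \<open>b\<close> letters of
  block \<open>q + a\<close> and the last \<open>b\<close> letters of block \<open>q - a\<close> form the same set \<open>P\<close>.  Comparing
  block \<open>q\<close> with these two blocks leaves fewer than \<open>b\<close> positions of block \<open>q\<close> for the \<open>b\<close>
  letters of \<open>P\<close>, a contradiction.
\<close>

section \<open>Block sequences\<close>

definition letter_count :: "(nat \<Rightarrow> 'a) \<Rightarrow> 'a \<Rightarrow> nat \<Rightarrow> nat \<Rightarrow> nat" where
  "letter_count f c x y = (\<Sum>i=x..<y. of_bool (f i = c))"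

lemma letter_count_split:
  "x \<le> y \<Longrightarrow> y \<le> z \<Longrightarrow> letter_count f c x z = letter_count f c x y + letter_count f c y z"
  unfolding letter_count_def by (rule sum.atLeastLessThan_concat[symmetric])

lemma letter_count_eq_of_bool:
  assumes "inj_on f {x..<y}"
  shows "letter_count f c x y = of_bool (c \<in> f ` {x..<y})"
proof (cases "c \<in> f ` {x..<y}")
  case True
  then obtain j where j: "j \<in> {x..<y}" "f j = c" by auto
  then have "letter_count f c x y = (\<Sum>i=x..<y. if i = j then 1 else 0)"
    unfolding letter_count_def using assms by (intro sum.cong) (auto dest: inj_onD)
  with j True show ?thesis by simp
qed (auto simp: letter_count_def intro!: sum.neutral)

text \<open>Moving a window of length \<open>m\<close> one step right drops \<open>f y\<close> and
  gains \<open>f (y + m)\<close>, the same letter. Periodicity holds up to \<open>p + m\<close>, so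
  the last window may start at \<open>p + m + 1\<close>.\<close>

lemma letter_count_window_const:
  assumes per: "\<And>i. p \<le> i \<Longrightarrow> i \<le> p + m \<Longrightarrow> f i = f (i + m)"
    and "p \<le> x" and "x \<le> y" and "y \<le> p + m + 1"
  shows "letter_count f c x (x + m) = letter_count f c y (y + m)"
  using \<open>x \<le> y\<close> \<open>y \<le> p + m + 1\<close>
proof (induction y rule: dec_induct)
  case (step y)
  have "f y = f (y + m)" using step \<open>p \<le> x\<close> by (intro per) auto
  moreover have "letter_count f c y (Suc y + m) = letter_count f c y (y + m) + of_bool (f (y + m) = c)"
    by (simp add: letter_count_def)
  moreover have "letter_count f c y (Suc y + m) = of_bool (f y = c) + letter_count f c (Suc y) (Suc y + m)"
    using letter_count_split[of y "Suc y" "Suc y + m" f c] by (simp add: letter_count_def)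
  ultimately show ?case using step by simp
qed simp

section \<open>Sequences whose blocks are permutations of the alphabet\<close>

locale block_sequence =
  fixes n :: nat and f :: "nat \<Rightarrow> 'a" and A :: "'a set"
  assumes block_bij: "\<And>q. bij_betw (\<lambda>s. f (n * q + s)) {..<n} A"
begin

lemma block_inj: "s < n \<Longrightarrow> s' < n \<Longrightarrow> f (n * q + s) = f (n * q + s') \<longleftrightarrow> s = s'"
  using block_bij[of q] by (auto simp: bij_betw_def inj_on_def)

lemma block_inj_on: "s' \<le> n \<Longrightarrow> inj_on f {n * q + s..<n * q + s'}"
proof (rule inj_onI)
  fix i j assume "s' \<le> n" "i \<in> {n * q + s..<n * q + s'}" "j \<in> {n * q + s..<n * q + s'}" "f i = f j"
  moreover from this have "i - n * q < n" "j - n * q < n" by auto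
  ultimately show "i = j"
    using block_inj[of "i - n * q" "j - n * q" q] by auto
qed

lemma block_ex: "c \<in> A \<Longrightarrow> \<exists>s<n. c = f (n * q + s)"
  using block_bij[of q] by (auto simp: bij_betw_def)

lemma block_in: "s < n \<Longrightarrow> f (n * q + s) \<in> A"
  using block_bij[of q] by (auto simp: bij_betw_def)

lemma letter_count_blocks:
  assumes "c \<in> A"
  shows "letter_count f c (n * q) (n * (q + a)) = a"
proof (induction a)
  case (Suc a)
  have "c \<in> f ` {n * (q + a)..<n * (q + a) + n}"
    using block_ex[OF assms, of "q + a"] by auto
  then have "letter_count f c (n * (q + a)) (n * (q + a) + n) = 1"
    using letter_count_eq_of_bool[OF block_inj_on[of n "q + a" 0], of c] by simp
  moreover have "n * (q + Suc a) = n * (q + a) + n" by simp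
  ultimately show ?case
    using Suc letter_count_split[of "n * q" "n * (q + a)" "n * (q + a) + n" f c]
    by (simp only:) simp
qed (simp add: letter_count_def)

text \<open>Leaves only periods divisible by \<open>n\<close>, on which the descent can act.\<close>

lemma overlap_period_dvd:
  assumes per: "\<And>i. p \<le> i \<Longrightarrow> i \<le> p + m \<Longrightarrow> f i = f (i + m)" and "m > 0" and "n > 0"
  shows "n dvd m"
proof (rule ccontr)
  assume "\<not> n dvd m"
  define a b where "a = m div n" and "b = m mod n"
  have m: "m = n * a + b" unfolding a_def b_def by simp
  have b: "0 < b" "b < n" using \<open>\<not> n dvd m\<close> \<open>n > 0\<close> by (auto simp: b_def dvd_eq_mod_eq_0)
  \<comment> \<open>Block and offset of the central letter of the overlap, which is matched both
    with position \<open>p\<close> and with \<open>p + 2 * m\<close>.\<close>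
  define q r where "q = (p + m) div n" and "r = (p + m) mod n"
  have pm: "p + m = n * q + r" unfolding q_def r_def by simp
  have r: "r < n" using \<open>n > 0\<close> by (simp add: r_def)
  show False
  proof (cases "m < n")
    case True
    \<comment> \<open>Block \<open>q\<close> repeats a letter: either it contains \<open>p\<close>
      as well as \<open>p + m\<close>, or its first position lies in the periodic range and
      \<open>n * q + m\<close> is still in it.\<close>
    show False
    proof (cases "m \<le> r")
      case True
      then have "p = n * q + (r - m)" using pm by simp
      moreover have "f p = f (n * q + r)" using per[of p] pm by simp
      moreover have "r - m < n" "r - m \<noteq> r" using r \<open>m > 0\<close> \<open>m \<le> r\<close> by auto
      ultimately show False using block_inj r by blast
    next
      case False
      then have "f (n * q) = f (n * q + m)" using pm by (intro per) auto
      then show False using block_inj[of 0 m q] \<open>m < n\<close> \<open>m > 0\<close> by simp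
    qed
  next
    case False
    then have "n < m" using \<open>\<not> n dvd m\<close> by (metis dvd_refl linorder_neqE_nat)
    have "n * a \<le> n * q" using pm m b r \<open>n < m\<close>
      by (metis a_def div_le_mono le_add2 mult_le_mono2 q_def)
    then have "a \<le> q" using \<open>n > 0\<close> by simp
    then obtain q' where q': "q = q' + a" by (metis add.commute le_Suc_ex)
    have start: "p \<le> n * q" using pm r \<open>n < m\<close> by simp
    define P where "P = f ` {n * (q + a)..<n * (q + a) + b}"
    have P_sub: "P \<subseteq> A"
      unfolding P_def using block_in[of _ "q + a"] b by (force simp: le_iff_add)
    have card_P: "card P = b"
      unfolding P_def using card_image[OF block_inj_on[of b "q + a" 0]] b by simp
    have P_last: "c \<in> f ` {n * q' + (n - b)..<n * q' + n}" if "c \<in> P" for c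
    proof -
      have c: "c \<in> A" using that P_sub by auto
      \<comment> \<open>The window from \<open>?y\<close> consists of the last \<open>b\<close>
        letters of block \<open>q'\<close> and \<open>a\<close> whole blocks; the one from
        \<open>n * q\<close> of \<open>a\<close> whole blocks and the first \<open>b\<close> letters
        of block \<open>q + a\<close>. The latter contains \<open>c\<close> exactly
        \<open>a + 1\<close> times.\<close>
      let ?y = "n * q' + (n - b)"
      have end_y: "?y + m = n * (q' + 1 + a)" using m b by (simp add: algebra_simps)
      have "n * q + n = ?y + m" using end_y q' by (simp add: algebra_simps)
      then have y: "p \<le> ?y" "?y \<le> n * q" "n * q \<le> p + m + 1" using pm r \<open>n < m\<close> by auto
      have "letter_count f c ?y (?y + m) = letter_count f c (n * q) (n * q + m)"
        using per y by (rule letter_count_window_const)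
      also have "\<dots> = a + 1"
      proof -
        have "n * q + m = n * (q + a) + b" using m by (simp add: algebra_simps)
        moreover have "letter_count f c (n * (q + a)) (n * (q + a) + b) = 1"
          using letter_count_eq_of_bool[OF block_inj_on[of b "q + a" 0], of c] that b
          unfolding P_def by simp
        ultimately show ?thesis
          using letter_count_split[of "n * q" "n * (q + a)" "n * (q + a) + b" f c]
            letter_count_blocks[OF c, of q a] by simp
      qed
      also have "letter_count f c ?y (?y + m) = letter_count f c ?y (n * q' + n) + a"
        unfolding end_y
        using letter_count_split[of ?y "n * (q' + 1)" "n * (q' + 1 + a)" f c]
          letter_count_blocks[OF c, of "q' + 1" a] by (simp add: algebra_simps)
      finally have "letter_count f c ?y (n * q' + n) = 1" by simp
      then show ?thesis
        using letter_count_eq_of_bool[OF block_inj_on[of n q' "n - b"], of c]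
        by (metis of_bool_eq_1_iff order_refl)
    qed
    \<comment> \<open>Offsets in block \<open>q\<close> open to letters of \<open>P\<close>. Both
      conditions apply at \<open>s = r\<close>, the central letter; if only the second did,
      \<open>r = 0\<close> would allow \<open>b\<close> offsets and give no contradiction.\<close>
    define T where "T = {s. s < n \<and> (s \<le> r \<longrightarrow> n - b \<le> s) \<and> (r \<le> s \<longrightarrow> s < b)}"
    have "P \<subseteq> (\<lambda>s. f (n * q + s)) ` T"
    proof
      fix c assume c: "c \<in> P"
      then obtain s where s: "s < n" "c = f (n * q + s)" using block_ex[of c q] P_sub by auto
      \<comment> \<open>A shift by \<open>m\<close> to the right leads to offset
        \<open>b + s\<close> of block \<open>q + a\<close>, if that is below \<open>n\<close>; but
        there \<open>P\<close> fills the offsets below \<open>b\<close>.\<close>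
      have "n - b \<le> s" if "s \<le> r"
      proof (rule ccontr)
        assume "\<not> n - b \<le> s"
        have "f (n * q + s) = f (n * q + s + m)" using that start pm by (intro per) auto
        then have "c = f (n * (q + a) + (b + s))" using s m by (simp add: algebra_simps)
        moreover obtain s' where "s' < b" "c = f (n * (q + a) + s')"
          using c unfolding P_def by (auto simp: le_iff_add)
        moreover have "b + s < n" using \<open>\<not> n - b \<le> s\<close> by simp
        ultimately show False
          using block_inj[of "b + s" s' "q + a"] by simp
      qed
      \<comment> \<open>A shift by \<open>m\<close> to the left leads to offset \<open>s - b\<close>
        of block \<open>q'\<close>, if \<open>b \<le> s\<close>; but there the letters of
        \<open>P\<close> have offsets at least \<open>n - b\<close>.\<close>
      moreover have "s < b" if "r \<le> s"
      proof (rule ccontr)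
        assume "\<not> s < b"
        have shift: "n * q + s = n * q' + (s - b) + m"
          using m q' \<open>\<not> s < b\<close> by (simp add: algebra_simps)
        have "f (n * q' + (s - b)) = f (n * q' + (s - b) + m)"
          using that pm shift s \<open>n < m\<close> by (intro per) auto
        then have "c = f (n * q' + (s - b))" using s shift by simp
        moreover obtain s' where "n - b \<le> s'" "s' < n" "c = f (n * q' + s')"
        proof -
          obtain i where "n * q' + (n - b) \<le> i" "i < n * q' + n" "c = f i"
            using P_last[OF c] by auto
          then show thesis using that[of "i - n * q'"] by simp
        qed
        ultimately show False
          using block_inj[of "s - b" s' q'] b s \<open>\<not> s < b\<close> by auto
      qed
      ultimately show "c \<in> (\<lambda>s. f (n * q + s)) ` T" using s unfolding T_def by auto
    qed
    moreover have "finite T" unfolding T_def by simp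
    ultimately have "b \<le> card T" using card_P surj_card_le by metis
    moreover have "card T < b"
    proof -
      \<comment> \<open>The first case excludes \<open>s \<le> r\<close>, the second excludes
        \<open>r \<le> s\<close>, and the third forces \<open>n - b \<le> s < b\<close>.\<close>
      consider "r < n - b" | "b \<le> r" | "n - b \<le> r" "r < b" by linarith
      then show ?thesis
      proof cases
        case 1
        then have "T \<subseteq> {r<..<b}" unfolding T_def by auto
        then have "card T \<le> card {r<..<b}" by (intro card_mono) auto
        then show ?thesis using b by simp
      next
        case 2
        then have "T \<subseteq> {n - b..<r}" unfolding T_def by auto
        then have "card T \<le> card {n - b..<r}" by (intro card_mono) auto
        then show ?thesis using b r by simp
      next
        case 3
        then have "T \<subseteq> {n - b..<b}" unfolding T_def by auto
        then have "card T \<le> card {n - b..<b}" by (intro card_mono) auto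
        then show ?thesis using b by simp
      qed
    qed
    ultimately show False by simp
  qed
qed

end

text \<open>Descent on \<open>m\<close>. Block \<open>q\<close> is the row of \<open>f q\<close>, so
  a period \<open>n * m'\<close> between blocks becomes a period \<open>m'\<close> between their
  labels, which form \<open>f\<close> again. The start moves to \<open>p div n\<close>, so the
  induction is over all \<open>p\<close>.\<close>

theorem no_overlap_fixed_point:
  fixes f :: "nat \<Rightarrow> 'a" and R :: "'a \<Rightarrow> nat \<Rightarrow> 'a"
  assumes n: "n \<ge> 2"
    and fix_pt: "\<And>q s. s < n \<Longrightarrow> f (n * q + s) = R (f q) s"
    and f_in: "\<And>q. f q \<in> A"
    and row: "\<And>x. x \<in> A \<Longrightarrow> bij_betw (R x) {..<n} A"
    and col: "\<And>s. s < n \<Longrightarrow> inj_on (\<lambda>x. R x s) A"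
    and "m > 0"
  shows "\<exists>i\<in>{p..p + m}. f i \<noteq> f (i + m)"
  using \<open>m > 0\<close>
proof (induction m arbitrary: p rule: less_induct)
  case (less m)
  interpret block_sequence n f A
  proof
    show "bij_betw (\<lambda>s. f (n * q + s)) {..<n} A" for q
      using row[OF f_in[of q]] by (rule bij_betw_cong[THEN iffD1, rotated]) (simp add: fix_pt)
  qed
  show ?case
  proof (rule ccontr)
    assume "\<not> ?thesis"
    then have per: "f i = f (i + m)" if "p \<le> i" "i \<le> p + m" for i using that by auto
    have "n dvd m" using overlap_period_dvd[of p m] per less.prems n by simp
    then obtain m' where m': "m = n * m'" by auto
    then have "0 < m'" "m' < m" using less.prems n by auto
    from less.IH[OF \<open>m' < m\<close> \<open>0 < m'\<close>, of "p div n"]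
    obtain q where q: "p div n \<le> q" "q \<le> p div n + m'" "f q \<noteq> f (q + m')" by auto
    \<comment> \<open>The interval \<open>{p..p + m}\<close> meets every block from \<open>p div n\<close> to \<open>p div n + m'\<close>.\<close>
    obtain s where s: "s < n" "p \<le> n * q + s" "n * q + s \<le> p + m"
    proof (cases "q = p div n")
      case True
      then show thesis using that[of "p mod n"] n by simp
    next
      case False
      define d r where "d = p div n" and "r = p mod n"
      have "d + 1 \<le> q" using q False by (simp add: d_def)
      then have "n * (d + 1) \<le> n * q" by (rule mult_le_mono2)
      moreover have "n * q \<le> n * (d + m')" using q by (intro mult_le_mono2) (simp add: d_def)
      moreover have "p = n * d + r" "r < n" using n by (auto simp: d_def r_def)
      ultimately have "p \<le> n * q" "n * q \<le> p + m" using m' by (auto simp: algebra_simps)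
      then show thesis using that[of 0] n by simp
    qed
    \<comment> \<open>Blocks \<open>q\<close> and \<open>q + m'\<close> agree in column
      \<open>s\<close>, so they are the same row.\<close>
    have "R (f q) s = R (f (q + m')) s"
      using per[OF s(2,3)] fix_pt[OF s(1), of q] fix_pt[OF s(1), of "q + m'"] m'
      by (simp add: algebra_simps)
    then show False using inj_onD[OF col[OF s(1)]] f_in q(3) by blast
  qed
qed

section \<open>The sequence of a Latin square morphism\<close>

lemma latin_row_eq:
  assumes "\<forall>i\<in>{1..n}. L i 1 = i" and "x \<in> {1..n}"
  shows "latin_row n L x = map (L x) [1..<Suc n]"
proof -
  have "(THE i. i \<in> {1..n} \<and> L i 1 = x) = x"
    using assms by (intro the_equality) auto
  then show ?thesis by (simp add: latin_row_def)
qed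

lemma length_concat_map_const:
  assumes "\<And>x. x \<in> set xs \<Longrightarrow> length (h x) = n"
  shows "length (concat (map h xs)) = n * length xs"
  using assms by (induction xs) auto

lemma nth_concat_map_const:
  assumes "\<And>x. x \<in> set xs \<Longrightarrow> length (h x) = n" and "q < length xs" and "s < n"
  shows "concat (map h xs) ! (n * q + s) = h (xs ! q) ! s"
  using assms
proof (induction xs arbitrary: q)
  case (Cons x xs)
  show ?case
  proof (cases q)
    case (Suc q')
    then show ?thesis using Cons.IH[of q'] Cons.prems by (simp add: nth_append)
  qed (use Cons.prems in \<open>simp add: nth_append\<close>)
qed simp

text \<open>For \<open>n \<ge> 2\<close> the lengths \<open>n ^ k\<close> are unbounded, so the
  limit is infinite and its letters can be read off the iterates. Offsets start at 0 but columns at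
  1, hence \<open>Suc s\<close>.\<close>

lemma omega_iterate_fixed_point:
  fixes L :: "nat \<Rightarrow> nat \<Rightarrow> nat"
  assumes latin: "latin_square n {1..n} L" and col1: "\<forall>i\<in>{1..n}. L i 1 = i"
    and t: "t \<in> {1..n}" and n: "n \<ge> 2"
  obtains f where "omega_iterate (latin_morphism n L) t = InfStr f"
    and "\<And>q. f q \<in> {1..n}"
    and "\<And>q s. s < n \<Longrightarrow> f (n * q + s) = L (f q) (Suc s)"
proof -
  let ?w = "omega_iterate (latin_morphism n L) t"
  define xs where "xs k = ((\<lambda>u. concat (map (latin_row n L) u)) ^^ k) [t]" for k
  have xs: "(latin_morphism n L ^^ k) (FinStr [t]) = FinStr (xs k)" for k
    by (induction k) (auto simp: xs_def latin_morphism_def)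
  have xs_Suc: "xs (Suc k) = concat (map (latin_row n L) (xs k))" for k
    by (simp add: xs_def)
  have row_in: "set (latin_row n L x) \<subseteq> {1..n}" if "x \<in> {1..n}" for x
    using latin_row_eq[of n L x] col1 latin that by (auto simp: latin_square_def simp del: upt_Suc)
  have row_length: "length (latin_row n L x) = n" for x
    by (simp add: latin_row_def)
  have in_A: "set (xs k) \<subseteq> {1..n}" for k
  proof (induction k)
    case (Suc k)
    then show ?case unfolding xs_Suc using row_in by fastforce
  qed (use t in \<open>simp add: xs_def\<close>)
  have len: "length (xs k) = n ^ k" for k
  proof (induction k)
    case (Suc k)
    then show ?case unfolding xs_Suc by (simp add: length_concat_map_const row_length)
  qed (simp add: xs_def)
  have pre: "\<exists>v. ?w = str_append (xs (Suc k)) v" for k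
    using shortest_extension_omega_iterate[OF latin col1 t]
    unfolding shortest_extension_def xs by simp
  \<comment> \<open>Position \<open>m\<close> lies inside the iterate
    \<open>xs (Suc m)\<close>.\<close>
  have large: "m < n ^ Suc m" for m
    using n by (metis Suc_lessD less_exp less_le_trans power_mono zero_le)
  obtain f where f: "?w = InfStr f"
  proof (cases ?w)
    case (FinStr u)
    have "enat (length (xs (Suc (length u)))) \<le> str_length ?w"
      using pre[of "length u"] length_le_str_append by metis
    with FinStr len large[of "length u"] show thesis by simp
  qed
  have f_xs: "f i = xs (Suc k) ! i" if i: "i < n ^ Suc k" for i k
  proof -
    obtain v where "InfStr f = str_append (xs (Suc k)) v" using pre[of k] f by auto
    then obtain g where "f = xs (Suc k) \<frown> g" by (cases v) auto
    then show ?thesis using i len[of "Suc k"] by simp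
  qed
  show thesis
  proof
    show "?w = InfStr f" by (rule f)
    show "f q \<in> {1..n}" for q
      using f_xs[OF large, of q] in_A[of "Suc q"] len[of "Suc q"] large[of q]
      by (metis nth_mem subsetD)
    then have row: "latin_row n L (f q) = map (L (f q)) [1..<Suc n]" for q
      using latin_row_eq[of n L "f q"] col1 by blast
    show "f (n * q + s) = L (f q) (Suc s)" if s: "s < n" for q s
    proof -
      \<comment> \<open>Since \<open>xs (Suc q)\<close> reaches position \<open>q\<close>, its image
        \<open>xs (Suc (Suc q))\<close> contains all of block \<open>q\<close>.\<close>
      have "n * q + s < n * Suc q" using s by simp
      also have "\<dots> \<le> n * n ^ Suc q" using large[of q] by (intro mult_le_mono2) simp
      finally have "f (n * q + s) = xs (Suc (Suc q)) ! (n * q + s)" by (intro f_xs) simp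
      also have "\<dots> = latin_row n L (xs (Suc q) ! q) ! s"
        unfolding xs_Suc[of "Suc q"] using len large s
        by (intro nth_concat_map_const) (simp_all add: row_length)
      also have "\<dots> = L (f q) (Suc s)"
        unfolding f_xs[OF large, symmetric] row using s by (simp del: upt_Suc)
      finally show ?thesis .
    qed
  qed
qed

section \<open>Rows and columns as injective maps\<close>

lemma latin_square_row_bij:
  assumes "latin_square n {1..n} L" and "x \<in> {1..n}"
  shows "bij_betw (\<lambda>s. L x (Suc s)) {..<n} {1..n}"
proof -
  have "L x j \<in> {1..n}" if "j \<in> {1..n}" for j
    using assms that unfolding latin_square_def by blast
  moreover have uniq: "\<exists>!j. j \<in> {1..n} \<and> L x j = c" if "c \<in> {1..n}" for c
    using assms that unfolding latin_square_def by blast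
  ultimately have "inj_on (L x) {1..n}" unfolding inj_on_def by metis
  moreover have "L x ` {1..n} = {1..n}"
    using \<open>\<And>j. j \<in> {1..n} \<Longrightarrow> L x j \<in> {1..n}\<close> uniq by blast
  ultimately have "bij_betw (L x) {1..n} {1..n}" by (simp add: bij_betw_def)
  moreover have "bij_betw Suc {..<n} {1..n}"
    by (auto simp: bij_betw_def image_Suc_lessThan)
  ultimately show ?thesis
    using bij_betw_trans[of Suc "{..<n}" "{1..n}" "L x" "{1..n}"] by (simp add: comp_def)
qed

lemma latin_square_column_inj:
  assumes "latin_square n \<Sigma> L" and "j \<in> {1..n}"
  shows "inj_on (\<lambda>x. L x j) {1..n}"
proof (rule inj_onI)
  fix x y assume "x \<in> {1..n}" "y \<in> {1..n}" "L x j = L y j"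
  moreover from this have "\<exists>!i. i \<in> {1..n} \<and> L i j = L x j"
    using assms unfolding latin_square_def by blast
  ultimately show "x = y" by metis
qed

text \<open>For \<open>n = 1\<close> every iterate is \<open>[1]\<close>, which therefore competes
  with the limit as an extension of all iterates; minimality bounds the length.\<close>

lemma omega_iterate_length_le_1:
  fixes L :: "nat \<Rightarrow> nat \<Rightarrow> nat"
  assumes latin: "latin_square 1 {1..1} L" and col1: "\<forall>i\<in>{1..1}. L i 1 = i"
  shows "str_length (omega_iterate (latin_morphism 1 L) 1) \<le> 1"
proof -
  have "latin_row 1 L 1 = [1]"
    using latin_row_eq[of 1 L 1] col1 by simp
  then have "(latin_morphism 1 L ^^ k) (FinStr [1]) = FinStr [1]" for k
    by (induction k) (auto simp: latin_morphism_def)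
  moreover have "str_prefix (FinStr [1]) (FinStr [1::nat])"
    using str_append.simps(1)[of "[1]" "[]"] by (metis append_Nil2 str_prefix.simps(1))
  ultimately have "str_length (omega_iterate (latin_morphism 1 L) 1) \<le> str_length (FinStr [1::nat])"
    using shortest_extension_omega_iterate[OF latin col1, of 1]
    unfolding shortest_extension_def by (metis atLeastAtMost_iff order_refl)
  then show ?thesis by (simp add: one_enat_def)
qed

text \<open>The period is the length of \<open>c\<close> followed by \<open>x\<close>. The bound
  \<open>i \<le> m\<close> includes the final \<open>c\<close>, which distinguishes an overlap from
  a square.\<close>

lemma is_overlap_periodic:
  assumes "is_overlap u"
  obtains m where "m > 0" "length u = 2 * m + 1" "\<And>i. i \<le> m \<Longrightarrow> u ! i = u ! (i + m)"
proof -
  obtain c x where u: "u = [c] @ x @ [c] @ x @ [c]" using assms by (auto simp: is_overlap_def)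
  show thesis
  proof
    show "u ! i = u ! (i + Suc (length x))" if "i \<le> Suc (length x)" for i
      using that unfolding u by (auto simp: nth_append nth_Cons split: nat.split)
  qed (simp_all add: u)
qed

theorem theorem3p1:
  fixes n t :: nat and L :: "nat \<Rightarrow> nat \<Rightarrow> nat"
  assumes "latin_square n {1..n} L"
    and "\<forall>i\<in>{1..n}. L i 1 = i"
    and "t \<in> {1..n}"
  shows "overlap_free (omega_iterate (latin_morphism n L) t)"
proof -
  have False if u: "is_overlap u" and fac: "str_factor u (omega_iterate (latin_morphism n L) t)" for u
  proof -
    obtain m where m: "m > 0" "length u = 2 * m + 1" "\<And>i. i \<le> m \<Longrightarrow> u ! i = u ! (i + m)"
      using is_overlap_periodic[OF u] by blast
    obtain y v where w: "omega_iterate (latin_morphism n L) t = str_append y (str_append u v)"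
      using fac unfolding str_factor_def by auto
    show False
    proof (cases "n \<ge> 2")
      case True
      obtain f where f: "omega_iterate (latin_morphism n L) t = InfStr f"
        and f_in: "\<And>q. f q \<in> {1..n}"
        and f_fix: "\<And>q s. s < n \<Longrightarrow> f (n * q + s) = L (f q) (Suc s)"
        using omega_iterate_fixed_point[OF assms True] by blast
      obtain g where g: "f = y \<frown> (u \<frown> g)"
        using f w by (cases v) auto
      have f_u: "f (length y + i) = u ! i" if "i < length u" for i
        using that by (simp add: g conc_def)
      obtain i where i: "i \<in> {length y..length y + m}" "f i \<noteq> f (i + m)"
        using no_overlap_fixed_point[where R = "\<lambda>x s. L x (Suc s)", OF True f_fix f_in
            latin_square_row_bij[OF assms(1)] _ m(1), of "length y"]
          latin_square_column_inj[OF assms(1)] by auto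
      define j where "j = i - length y"
      have "i = length y + j" "j \<le> m" using i by (auto simp: j_def)
      then show False using i m f_u[of j] f_u[of "j + m"] by (simp add: add.assoc)
    next
      case False
      then have n: "n = 1" "t = 1" using assms(3) by auto
      \<comment> \<open>An overlap has length \<open>2 * m + 1 \<ge> 3\<close>, too long for a word
        of length at most 1.\<close>
      have "enat (length (y @ u)) \<le> str_length (omega_iterate (latin_morphism n L) t)"
        unfolding w str_append_append by (rule length_le_str_append)
      also have "\<dots> \<le> 1" using omega_iterate_length_le_1[of L] assms n by simp
      finally show False using m by (simp add: one_enat_def)
    qed
  qed
  then show ?thesis unfolding overlap_free_def by blast
qed

end
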